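(* There is no map $\lambda$ which assigns an integer $\lambda(F)$ to every continuous multivalued map with acyclic values $F:X\multimap X$ of finite $T_0$ spaces $X$, and which satisfies both of the following properties: (1) $\lambda(f)=L(f)$ for each (continuous) single-valued map $f:X\to X$ of a finite $T_0$ space $X$, regarded as the multivalued map $x\mapsto\{f(x)\}$; (2) $\lambda(f)=\lambda(F)$ for each (continuous) selector $f$ of $F$.
   Context: A multivalued map $F:X\multimap Y$ between topological spaces assigns to each $x\in X$ a subset $F(x)\subset Y$. It is upper semicontinuous if for every open $B\subset Y$ the set $\{x\in X:F(x)\subset B\}$ is open, and lower semicontinuous if for every open $B\subset Y$ the set $\{x\in X:F(x)\cap B\neq\emptyset\}$ is open. $F$ is called continuous if it is both upper and lower semicontinuous. $F$ has acyclic values if each $F(x)$ (with the subspace topology) is acyclic, i.e. nonempty with all reduced singular homology groups with integer coefficients trivial. A selector of $F:X\multimap Y$ is a single-valued map $f:X\to Y$ with $f(x)\in F(x)$ for all $x\in X$. For a continuous single-valued map $f:X\to X$ of a finite $T_0$ space, $L(f)=\sum_{n\ge0}(-1)^n\operatorname{tr}\big(f_*: H_n(X)/\text{torsion}\to H_n(X)/\text{torsion}\big)$ is the usual Lefschetz number (singular integral homology). *)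

theory Defs
  imports "HOL-Analysis.Analysis" "HOL-Homology.Homology" "HOL-Library.Groups_Big_Fun"
begin

section \<open>Multivalued maps\<close>

text \<open>
  Multivalued maps are required to be extensional (\<^const>\<open>undefined\<close> outside the carrier), so that
  a HOL function satisfying \<open>multimap X Y\<close> is determined by its values on the space.
\<close>

definition multimap :: "'a topology \<Rightarrow> 'b topology \<Rightarrow> ('a \<Rightarrow> 'b set) \<Rightarrow> bool" where
  "multimap X Y F \<longleftrightarrow> F \<in> topspace X \<rightarrow>\<^sub>E Pow (topspace Y)"

definition upper_semicontinuous :: "'a topology \<Rightarrow> 'b topology \<Rightarrow> ('a \<Rightarrow> 'b set) \<Rightarrow> bool" where
  "upper_semicontinuous X Y F \<longleftrightarrow>
     (\<forall>B. openin Y B \<longrightarrow> openin X {x \<in> topspace X. F x \<subseteq> B})"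

definition lower_semicontinuous :: "'a topology \<Rightarrow> 'b topology \<Rightarrow> ('a \<Rightarrow> 'b set) \<Rightarrow> bool" where
  "lower_semicontinuous X Y F \<longleftrightarrow>
     (\<forall>B. openin Y B \<longrightarrow> openin X {x \<in> topspace X. F x \<inter> B \<noteq> {}})"

definition continuous_multimap :: "'a topology \<Rightarrow> 'b topology \<Rightarrow> ('a \<Rightarrow> 'b set) \<Rightarrow> bool" where
  "continuous_multimap X Y F \<longleftrightarrow>
     multimap X Y F \<and> upper_semicontinuous X Y F \<and> lower_semicontinuous X Y F"

definition acyclic_space :: "'a topology \<Rightarrow> bool" where
  "acyclic_space X \<longleftrightarrow>
     topspace X \<noteq> {} \<and> (\<forall>p. trivial_group (reduced_homology_group p X))"

definition acyclic_valued :: "'a topology \<Rightarrow> 'b topology \<Rightarrow> ('a \<Rightarrow> 'b set) \<Rightarrow> bool" where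
  "acyclic_valued X Y F \<longleftrightarrow> (\<forall>x \<in> topspace X. acyclic_space (subtopology Y (F x)))"

definition selector :: "'a topology \<Rightarrow> ('a \<Rightarrow> 'b set) \<Rightarrow> ('a \<Rightarrow> 'b) \<Rightarrow> bool" where
  "selector X F f \<longleftrightarrow> (\<forall>x \<in> topspace X. f x \<in> F x)"

definition single_multimap :: "'a topology \<Rightarrow> ('a \<Rightarrow> 'b) \<Rightarrow> 'a \<Rightarrow> 'b set" where
  "single_multimap X f = (\<lambda>x \<in> topspace X. {f x})"

definition finite_t0_space :: "'a topology \<Rightarrow> bool" where
  "finite_t0_space X \<longleftrightarrow> finite (topspace X) \<and> t0_space X"


section \<open>The Lefschetz number\<close>

text \<open>The groups below are abelian but, as in HOL-Algebra, written multiplicatively.\<close>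

definition torsion_part :: "('g, 'm) monoid_scheme \<Rightarrow> 'g set" where
  "torsion_part G = {x \<in> carrier G. \<exists>k::nat. 0 < k \<and> x [^]\<^bsub>G\<^esub> k = \<one>\<^bsub>G\<^esub>}"

text \<open>
  The map induced on \<open>G Mod torsion_part G\<close> by an endomorphism \<open>h\<close> of \<open>G\<close>. The image of the coset of
  \<open>x\<close> under \<open>h\<close> is in general only a part of the coset of \<open>h x\<close>; multiplying it with the torsion
  part yields the whole coset.
\<close>

definition mod_torsion_map :: "('g, 'm) monoid_scheme \<Rightarrow> ('g \<Rightarrow> 'g) \<Rightarrow> 'g set \<Rightarrow> 'g set" where
  "mod_torsion_map G h = (\<lambda>C. torsion_part G <#>\<^bsub>G\<^esub> (h ` C))"

definition coordinates ::
  "('g, 'm) monoid_scheme \<Rightarrow> 'g set \<Rightarrow> 'g \<Rightarrow> ('g \<Rightarrow> int) \<Rightarrow> bool" where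
  "coordinates G B x c \<longleftrightarrow>
     c \<in> B \<rightarrow>\<^sub>E UNIV \<and> x = finprod G (\<lambda>b. b [^]\<^bsub>G\<^esub> c b) B"

definition finite_basis :: "('g, 'm) monoid_scheme \<Rightarrow> 'g set \<Rightarrow> bool" where
  "finite_basis G B \<longleftrightarrow>
     finite B \<and> B \<subseteq> carrier G \<and> (\<forall>x \<in> carrier G. \<exists>!c. coordinates G B x c)"

definition coordinate :: "('g, 'm) monoid_scheme \<Rightarrow> 'g set \<Rightarrow> 'g \<Rightarrow> 'g \<Rightarrow> int" where
  "coordinate G B x = (THE c. coordinates G B x c)"

text \<open>
  The trace of an endomorphism of a finitely generated free abelian group is the sum of the diagonal
  entries of its matrix, for any choice of basis; it is meaningful only if a finite basis exists.
\<close>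

definition group_trace :: "('g, 'm) monoid_scheme \<Rightarrow> ('g \<Rightarrow> 'g) \<Rightarrow> int" where
  "group_trace G h = (let B = (SOME B. finite_basis G B) in \<Sum>b\<in>B. coordinate G B (h b) b)"

definition homology_trace :: "nat \<Rightarrow> 'a topology \<Rightarrow> ('a \<Rightarrow> 'a) \<Rightarrow> int" where
  "homology_trace n X f =
     (let G = homology_group (int n) X
      in group_trace (G Mod torsion_part G)
           (mod_torsion_map G (hom_induced (int n) X {} X {} f)))"

text \<open>
  \<^const>\<open>Sum_any\<close> sums over the support. For a finite \<open>T\<^sub>0\<close> space the homology groups are finitely
  generated and vanish in all but finitely many degrees, so the alternating sum is finite.
\<close>

definition lefschetz_number :: "'a topology \<Rightarrow> ('a \<Rightarrow> 'a) \<Rightarrow> int" where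
  "lefschetz_number X f = Sum_any (\<lambda>n::nat. (-1) ^ n * homology_trace n X f)"


section \<open>Integer invariants of multivalued maps\<close>

text \<open>
  An assignment \<open>\<lambda>\<close> takes a space and a multivalued self-map of it. HOL functions are total, so \<open>\<lambda>\<close>
  also has values on other arguments, but those are left unconstrained.
\<close>

definition extends_lefschetz :: "('a topology \<Rightarrow> ('a \<Rightarrow> 'a set) \<Rightarrow> int) \<Rightarrow> bool" where
  "extends_lefschetz lam \<longleftrightarrow>
     (\<forall>X f. finite_t0_space X \<and> continuous_map X X f \<longrightarrow>
        lam X (single_multimap X f) = lefschetz_number X f)"

definition selector_invariant :: "('a topology \<Rightarrow> ('a \<Rightarrow> 'a set) \<Rightarrow> int) \<Rightarrow> bool" where
  "selector_invariant lam \<longleftrightarrow>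
     (\<forall>X F f. finite_t0_space X \<and> continuous_multimap X X F \<and> acyclic_valued X X F \<and>
        continuous_map X X f \<and> selector X F f \<longrightarrow>
        lam X (single_multimap X f) = lam X F)"

text \<open>
  A HOL function cannot range over spaces of all types, so the points of the spaces are taken from one
  ambient type. When that type is infinite, every finite space is homeomorphic to one with points in it.
\<close>

end

theory Submission
  imports Defs
begin

text \<open>
  On the four-point model of the circle, with minimal points \<open>a, b\<close> and maximal points \<open>c, d\<close>, the
  continuous map with contractible values
  \<open>a \<mapsto> {a}, b \<mapsto> {a, b, c}, c \<mapsto> {a, c}, d \<mapsto> {a, c, d}\<close>
  has both the identity and the constant map \<open>a\<close> among its selectors. These induce the same map on
  \<open>H\<^sub>0\<close>, but on \<open>H\<^sub>1 \<cong> \<int>\<close> one is the identity and the other is zero, so their Lefschetz numbers differ.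
\<close>

section \<open>Bases and traces\<close>

lemma (in comm_group) coordinates_basis_element:
  assumes "finite B" "B \<subseteq> carrier G" "b \<in> B"
  shows "coordinates G B b (\<lambda>x\<in>B. if x = b then 1 else 0)"
proof -
  have "(\<Otimes>x\<in>B. x [^] ((\<lambda>x\<in>B. if x = b then 1 else (0::int)) x)) = (\<Otimes>x\<in>B. if x = b then x else \<one>)"
    by (rule finprod_cong') (use assms in \<open>auto simp: int_pow_1\<close>)
  also have "\<dots> = b"
    using assms by (intro finprod_singleton_swap) auto
  finally show ?thesis
    unfolding coordinates_def by simp
qed

lemma (in comm_group) coordinates_one: "coordinates G B \<one> (\<lambda>x\<in>B. 0)"
proof -
  have "(\<Otimes>x\<in>B. x [^] ((\<lambda>x\<in>B. 0::int) x)) = \<one>"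
    by (rule finprod_one_eqI) auto
  then show ?thesis
    unfolding coordinates_def by simp
qed

lemma coordinate_eqI:
  assumes "finite_basis G B" "x \<in> carrier G" "coordinates G B x c"
  shows "coordinate G B x = c"
  unfolding coordinate_def using assms by (intro the1_equality) (auto simp: finite_basis_def)

text \<open>The basis picked by \<open>SOME\<close> depends on \<open>G\<close> alone, so a single
  \<open>B\<close> serves all \<open>h\<close>. Traces of different maps can then be compared in one
  basis, with no appeal to independence of the choice.\<close>

lemma group_trace_basisE:
  assumes "\<exists>B. finite_basis G B"
  obtains B where "finite_basis G B" "\<And>h. group_trace G h = (\<Sum>b\<in>B. coordinate G B (h b) b)"
  using someI_ex [OF assms] by (auto simp: group_trace_def Let_def)

lemma group_trace_cong:
  assumes "\<exists>B. finite_basis G B" "\<And>x. x \<in> carrier G \<Longrightarrow> h x = k x"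
  shows "group_trace G h = group_trace G k"
proof -
  obtain B where B: "finite_basis G B" "\<And>h. group_trace G h = (\<Sum>b\<in>B. coordinate G B (h b) b)"
    using group_trace_basisE [OF assms(1)] by blast
  then show ?thesis
    using assms(2) by (auto simp: finite_basis_def intro!: sum.cong)
qed

lemma (in comm_group) group_trace_one:
  assumes "\<exists>B. finite_basis G B"
  shows "group_trace G (\<lambda>x. \<one>) = 0"
proof -
  obtain B where B: "finite_basis G B" "\<And>h. group_trace G h = (\<Sum>b\<in>B. coordinate G B (h b) b)"
    using group_trace_basisE [OF assms] by blast
  then show ?thesis
    by (simp add: coordinate_eqI [OF B(1) one_closed coordinates_one])
qed

text \<open>The identity has trace \<open>card B\<close>, and an empty basis would generate only the
  unit.\<close>

lemma (in comm_group) group_trace_id_neq_0: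
  assumes "\<exists>B. finite_basis G B" "\<not> trivial_group G"
  shows "group_trace G (\<lambda>x. x) \<noteq> 0"
proof -
  obtain B where B: "finite_basis G B" "\<And>h. group_trace G h = (\<Sum>b\<in>B. coordinate G B (h b) b)"
    using group_trace_basisE [OF assms(1)] by blast
  have fin: "finite B" "B \<subseteq> carrier G"
    using B(1) by (auto simp: finite_basis_def)
  have "coordinate G B b b = 1" if "b \<in> B" for b
    using that fin coordinate_eqI [OF B(1) _ coordinates_basis_element [OF fin that]] by auto
  then have *: "group_trace G (\<lambda>x. x) = int (card B)"
    by (simp add: B(2))
  have "B \<noteq> {}"
  proof
    assume "B = {}"
    then have "x = \<one>" if "x \<in> carrier G" for x
      using B(1) that by (auto simp: finite_basis_def coordinates_def)
    then show False
      using assms(2) trivial_group_alt by blast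
  qed
  then show ?thesis
    using * fin by simp
qed

lemma (in comm_group) finite_basis_empty:
  assumes "trivial_group G"
  shows "finite_basis G {}"
proof -
  \<comment> \<open>Over the empty basis extensionality leaves exactly one coordinate function,
    which gives uniqueness.\<close>
  have "coordinates G {} \<one> c \<longleftrightarrow> c = (\<lambda>x. undefined)" for c
    by (simp add: coordinates_def)
  then show ?thesis
    using assms by (simp add: finite_basis_def trivial_group_def)
qed

text \<open>The image of 1 under an isomorphism from the integers is a one-element basis.\<close>

lemma (in comm_group) finite_basis_infinite_cyclic:
  assumes "integer_group \<cong> G"
  shows "\<exists>B. finite_basis G B"
proof -
  obtain h where h: "h \<in> iso integer_group G"
    using assms by (auto simp: is_iso_def)
  define g where "g = h 1"
  have g: "g \<in> carrier G"
    using h by (auto simp: g_def iso_def hom_def)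
  have h_eq: "h n = g [^] n" for n :: int
    using hom_int_pow [of h integer_group G 1 n] h by (simp add: g_def iso_def is_group)
  have bij: "bij_betw (\<lambda>n::int. g [^] n) UNIV (carrier G)"
  proof -
    have "h = (\<lambda>n. g [^] n)"
      using h_eq by blast
    then show ?thesis
      using h by (simp add: iso_def)
  qed
  have fp: "(\<Otimes>b\<in>{g}. b [^] c b) = g [^] c g" for c :: "'a \<Rightarrow> int"
    using g by simp
  have "\<exists>!c. coordinates G {g} x c" if "x \<in> carrier G" for x
  proof -
    have "x \<in> range (\<lambda>n::int. g [^] n)"
      using bij that by (simp only: bij_betw_imp_surj_on)
    then obtain n :: int where n: "g [^] n = x"
      by blast
    show ?thesis
    proof (rule ex1I)
      show "coordinates G {g} x (\<lambda>b\<in>{g}. n)"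
        unfolding coordinates_def fp using n by simp
    next
      fix c
      assume c: "coordinates G {g} x c"
      then have "g [^] c g = g [^] n"
        unfolding coordinates_def fp using n by simp
      then have "c g = n"
        using inj_onD [OF bij_betw_imp_inj_on [OF bij]] by blast
      \<comment> \<open>Injectivity settles the value at \<open>g\<close>; extensionality settles
        all others.\<close>
      moreover have "c \<in> extensional {g}"
        using c by (simp add: coordinates_def PiE_def)
      ultimately show "c = (\<lambda>b\<in>{g}. n)"
        by (auto simp: extensional_def)
    qed
  qed
  then have "finite_basis G {g}"
    using g by (simp add: finite_basis_def)
  then show ?thesis ..
qed

section \<open>Traces modulo a trivial torsion part\<close>

lemma (in group) torsion_part_infinite_cyclic:
  assumes "G \<cong> integer_group"
  shows "torsion_part G = {\<one>}"
proof -
  obtain h where h: "h \<in> iso G integer_group"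
    using assms by (auto simp: is_iso_def)
  then interpret group_hom G integer_group h
    by (simp add: group_hom_def group_hom_axioms_def iso_def)
  have "x = \<one>" if x: "x \<in> carrier G" "0 < k" "x [^] k = \<one>" for x and k :: nat
  proof -
    \<comment> \<open>The isomorphism turns a power into an integer multiple, and the integers have
      no zero divisors.\<close>
    have "int k * h x = 0"
      using hom_nat_pow [OF x(1), of k] x(3) hom_one by simp
    moreover have "h \<one> = 0"
      using hom_one by (simp only: one_integer_group)
    ultimately have "h x = h \<one>"
      using x(2) by simp
    moreover have "inj_on h (carrier G)"
      using h by (simp add: iso_def bij_betw_def)
    ultimately show ?thesis
      using x(1) one_closed by (blast dest: inj_onD)
  qed
  then show ?thesis
    by (auto simp: torsion_part_def intro: exI [of _ 1])
qed

lemma (in group) torsion_part_trivial_group: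
  assumes "trivial_group G"
  shows "torsion_part G = {\<one>}"
  using assms by (auto simp: torsion_part_def trivial_group_def intro: exI [of _ 1])

lemma (in group) carrier_FactGroup_one: "carrier (G Mod {\<one>}) = (\<lambda>x. {x}) ` carrier G"
  by (auto simp: FactGroup_def RCOSETS_def r_coset_def)

lemma (in group) mod_torsion_map_singleton:
  assumes "torsion_part G = {\<one>}" "h x \<in> carrier G"
  shows "mod_torsion_map G h {x} = {h x}"
  using assms by (simp add: mod_torsion_map_def set_mult_def)

context comm_group
begin

context
  assumes torsion_free: "torsion_part G = {\<one>}"
    and basis: "\<exists>B. finite_basis (G Mod torsion_part G) B"
begin

text \<open>The cosets of the trivial subgroup are the singletons \<open>{x}\<close> with
  \<open>x\<close> in the carrier, so the induced map sees only the values of \<open>h\<close>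
  there.\<close>

lemma torsion_free_trace_cong:
  assumes "\<And>x. x \<in> carrier G \<Longrightarrow> h x = k x"
  shows "group_trace (G Mod torsion_part G) (mod_torsion_map G h)
       = group_trace (G Mod torsion_part G) (mod_torsion_map G k)"
  using assms
  by (intro group_trace_cong [OF basis]) (auto simp: torsion_free carrier_FactGroup_one mod_torsion_map_def)

lemma torsion_free_trace_eq_0:
  assumes "\<And>x. x \<in> carrier G \<Longrightarrow> h x = \<one>"
  shows "group_trace (G Mod torsion_part G) (mod_torsion_map G h) = 0"
proof -
  interpret Q: comm_group "G Mod {\<one>}"
    by (simp add: abelian_FactGroup triv_subgroup)
  have "group_trace (G Mod {\<one>}) (mod_torsion_map G h)
      = group_trace (G Mod {\<one>}) (\<lambda>x. \<one>\<^bsub>G Mod {\<one>}\<^esub>)"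
    using basis assms
    by (intro group_trace_cong)
       (auto simp: torsion_free carrier_FactGroup_one mod_torsion_map_singleton)
  also have "\<dots> = 0"
    using basis by (intro Q.group_trace_one) (simp add: torsion_free)
  finally show ?thesis
    by (simp add: torsion_free)
qed

lemma torsion_free_trace_id_neq_0:
  assumes "\<not> trivial_group G" "\<And>x. x \<in> carrier G \<Longrightarrow> h x = x"
  shows "group_trace (G Mod torsion_part G) (mod_torsion_map G h) \<noteq> 0"
proof -
  interpret Q: comm_group "G Mod {\<one>}"
    by (simp add: abelian_FactGroup triv_subgroup)
  have "group_trace (G Mod {\<one>}) (mod_torsion_map G h) = group_trace (G Mod {\<one>}) (\<lambda>x. x)"
    using basis assms(2)
    by (intro group_trace_cong)
       (auto simp: torsion_free carrier_FactGroup_one mod_torsion_map_singleton)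
  \<comment> \<open>Stripping the braces from singleton cosets is an isomorphism onto
    \<open>G\<close>, so nontriviality passes to the quotient.\<close>
  moreover have "\<not> trivial_group (G Mod {\<one>})"
    using assms(1) trivial_factor_iso isomorphic_group_triviality1 is_group is_isoI by blast
  ultimately show ?thesis
    using basis by (simp add: torsion_free Q.group_trace_id_neq_0)
qed

end

end

text \<open>Without a finite basis \<^const>\<open>group_trace\<close> is a junk value, even for the zero map.\<close>

lemma torsion_free_basis_if_infinite_cyclic_or_trivial:
  assumes "comm_group G" "G \<cong> integer_group \<or> trivial_group G"
  shows "torsion_part G = {\<one>\<^bsub>G\<^esub>}" "\<exists>B. finite_basis (G Mod torsion_part G) B"
proof -
  interpret G: comm_group G by fact
  interpret Q: comm_group "G Mod {\<one>\<^bsub>G\<^esub>}"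
    by (simp add: G.abelian_FactGroup G.triv_subgroup)
  show T: "torsion_part G = {\<one>\<^bsub>G\<^esub>}"
    using assms(2) G.torsion_part_infinite_cyclic G.torsion_part_trivial_group by blast
  have iso: "G Mod {\<one>\<^bsub>G\<^esub>} \<cong> G"
    using G.trivial_factor_iso is_isoI by blast
  from assms(2) have "\<exists>B. finite_basis (G Mod {\<one>\<^bsub>G\<^esub>}) B"
  proof
    assume "G \<cong> integer_group"
    then show ?thesis
      using iso iso_trans Q.iso_sym Q.finite_basis_infinite_cyclic by blast
  next
    assume "trivial_group G"
    then show ?thesis
      using iso isomorphic_group_triviality G.is_group Q.is_group Q.finite_basis_empty by blast
  qed
  then show "\<exists>B. finite_basis (G Mod torsion_part G) B"
    by (simp add: T)
qed

section \<open>Contractibility\<close>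

text \<open>The homotopy rests at the identity and jumps to \<open>c\<close> at time 1. The jump is
  continuous: an open set containing \<open>c\<close> is the whole space, and any other open
  \<open>U\<close> has preimage [0,1) x \<open>U\<close>.\<close>

lemma contractible_space_top_point:
  assumes c: "c \<in> topspace X" and top: "\<And>U. openin X U \<Longrightarrow> c \<in> U \<Longrightarrow> U = topspace X"
  shows "contractible_space X"
proof -
  let ?I = "top_of_set {0..1::real}"
  let ?H = "\<lambda>(t::real, x). if t < 1 then x else c"
  have "continuous_map (prod_topology ?I X) X ?H"
    unfolding continuous_map_def
  proof (intro conjI allI impI)
    show "?H \<in> topspace (prod_topology ?I X) \<rightarrow> topspace X"
      using c by auto
  next
    fix U
    assume U: "openin X U"
    show "openin (prod_topology ?I X) {p \<in> topspace (prod_topology ?I X). ?H p \<in> U}"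
    proof (cases "c \<in> U")
      case True
      then have "{p \<in> topspace (prod_topology ?I X). ?H p \<in> U} = topspace (prod_topology ?I X)"
        using top [OF U] by auto
      then show ?thesis
        by (simp only: openin_topspace)
    next
      case False
      then have "{p \<in> topspace (prod_topology ?I X). ?H p \<in> U} = ({0..1} \<inter> {..<1}) \<times> U"
        using openin_subset [OF U] by (auto split: if_splits)
      moreover have "openin ?I ({0..1} \<inter> {..<1::real})"
        by (rule openin_open_Int) auto
      ultimately show ?thesis
        using U by (simp add: openin_prod_Times_iff)
    qed
  qed
  then have "homotopic_with (\<lambda>x. True) X X id (\<lambda>x. c)"
    unfolding homotopic_with_def by (intro exI [of _ ?H]) auto
  then show ?thesis
    unfolding contractible_space_def ..
qed

text \<open>Dually, the homotopy leaves the identity immediately after time 0, which is continuous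
  because \<open>a\<close> lies in every nonempty open set.\<close>

lemma contractible_space_bottom_point:
  assumes a: "a \<in> topspace X" and bot: "\<And>U. openin X U \<Longrightarrow> U \<noteq> {} \<Longrightarrow> a \<in> U"
  shows "contractible_space X"
proof -
  let ?I = "top_of_set {0..1::real}"
  let ?H = "\<lambda>(t::real, x). if t > 0 then a else x"
  have "continuous_map (prod_topology ?I X) X ?H"
    unfolding continuous_map_def
  proof (intro conjI allI impI)
    show "?H \<in> topspace (prod_topology ?I X) \<rightarrow> topspace X"
      using a by auto
  next
    fix U
    assume U: "openin X U"
    show "openin (prod_topology ?I X) {p \<in> topspace (prod_topology ?I X). ?H p \<in> U}"
    proof (cases "U = {}")
      case True
      then show ?thesis by simp
    next
      case False
      \<comment> \<open>Only time 0 requires the rectangle over \<open>U\<close>; extending it to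
        all times adds no points and makes it open.\<close>
      then have "{p \<in> topspace (prod_topology ?I X). ?H p \<in> U}
          = ({0..1} \<inter> {0<..}) \<times> topspace X \<union> {0..1} \<times> U"
        using bot [OF U] openin_subset [OF U] by (auto split: if_splits)
      moreover have "openin ?I ({0..1} \<inter> {0<..})"
        by (rule openin_open_Int) auto
      moreover have "openin ?I {0..1}"
        using openin_topspace [of ?I] by simp
      ultimately show ?thesis
        using U by (auto simp: openin_prod_Times_iff)
    qed
  qed
  then have "homotopic_with (\<lambda>x. True) X X id (\<lambda>x. a)"
    unfolding homotopic_with_def by (intro exI [of _ ?H]) auto
  then show ?thesis
    unfolding contractible_space_def ..
qed

lemma acyclic_space_contractible:
  "contractible_space X \<Longrightarrow> topspace X \<noteq> {} \<Longrightarrow> acyclic_space X"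
  by (simp add: acyclic_space_def trivial_reduced_homology_group_contractible_space)

section \<open>Induced maps\<close>

text \<open>Reduced homology in degree 0 is the kernel of the map induced by \<open>X\<close> to a
  point. If it is trivial, that map is injective, and it cannot tell \<open>f\<close> from
  \<open>g\<close> because both become the same map after collapsing to the point.\<close>

lemma hom_induced_0_eq:
  assumes "trivial_group (reduced_homology_group 0 X)"
    and f: "continuous_map X X f" and g: "continuous_map X X g"
    and x: "x \<in> carrier (homology_group 0 X)"
  shows "hom_induced 0 X {} X {} f x = hom_induced 0 X {} X {} g x"
proof -
  let ?P = "discrete_topology {()}"
  let ?r = "hom_induced 0 X {} ?P {} (\<lambda>x. ())"
  interpret r: group_hom "homology_group 0 X" "homology_group 0 ?P" ?r
    by (simp add: group_hom_def group_hom_axioms_def hom_induced_empty_hom)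
  have "kernel (homology_group 0 X) (homology_group 0 ?P) ?r = {\<one>\<^bsub>homology_group 0 X\<^esub>}"
    using assms(1)
    by (simp add: trivial_group_def one_reduced_homology_group flip: carrier_reduced_homology_group)
  then have inj: "inj_on ?r (carrier (homology_group 0 X))"
    by (simp add: r.inj_iff_trivial_ker)
  have "continuous_map X ?P (\<lambda>x. ())"
    by simp
  then have "?r (hom_induced 0 X {} X {} k x) = ?r x" if "continuous_map X X k" for k
    using that by (simp add: hom_induced_compose' o_def)
  then show ?thesis
    using f g by (intro inj_onD [OF inj]) (simp_all add: hom_induced_carrier)
qed

text \<open>A constant map factors through a point, whose homology vanishes outside degree
  0.\<close>

lemma hom_induced_const:
  assumes "p \<noteq> 0" "a \<in> topspace X" "x \<in> carrier (homology_group p X)"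
  shows "hom_induced p X {} Y {} (\<lambda>x. a) x = \<one>\<^bsub>homology_group p Y\<^esub>"
proof (cases "a \<in> topspace Y")
  case True
  let ?P = "discrete_topology {()}"
  let ?i = "hom_induced p ?P {} Y {} (\<lambda>u. a)"
  let ?r = "hom_induced p X {} ?P {} (\<lambda>x. ())"
  have "hom_induced p X {} Y {} (\<lambda>x. a) x = ?i (?r x)"
    using True by (simp add: hom_induced_compose' o_def)
  moreover have "?r x = \<one>\<^bsub>homology_group p ?P\<^esub>"
    using homology_dimension_axiom [of ?P "()" p] assms(1) hom_induced_carrier
    by (fastforce simp: trivial_group_def)
  moreover have "?i \<one>\<^bsub>homology_group p ?P\<^esub> = \<one>\<^bsub>homology_group p Y\<^esub>"
    by (intro hom_one) (auto intro: hom_induced_empty_hom)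
  ultimately show ?thesis
    by simp
next
  \<comment> \<open>Here the constant map is not continuous, as \<open>X\<close> is nonempty, and
    \<open>hom_induced\<close> returns the unit by default.\<close>
  case False
  then show ?thesis
    using assms by (intro hom_induced_default) (auto simp: continuous_map_def)
qed

section \<open>The four-point circle\<close>

locale four_points =
  fixes a b c d :: 'a
  assumes distinct: "distinct [a, b, c, d]"
begin

text \<open>The open sets are the down-sets of the order in which \<open>a\<close> and
  \<open>b\<close> lie below both \<open>c\<close> and \<open>d\<close>.\<close>

definition circle :: "'a topology" where
  "circle = topology (\<lambda>U. U \<subseteq> {a, b, c, d} \<and> (c \<in> U \<or> d \<in> U \<longrightarrow> a \<in> U \<and> b \<in> U))"

lemma openin_circle:
  "openin circle U \<longleftrightarrow> U \<subseteq> {a, b, c, d} \<and> (c \<in> U \<or> d \<in> U \<longrightarrow> a \<in> U \<and> b \<in> U)"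
proof -
  have "istopology (\<lambda>U. U \<subseteq> {a, b, c, d} \<and> (c \<in> U \<or> d \<in> U \<longrightarrow> a \<in> U \<and> b \<in> U))"
    unfolding istopology_def by blast
  then show ?thesis
    by (simp add: circle_def)
qed

lemma topspace_circle [simp]: "topspace circle = {a, b, c, d}"
  using distinct by (auto simp: topspace_def openin_circle)

lemma finite_t0_space_circle: "finite_t0_space circle"
proof -
  \<comment> \<open>For a point \<open>x\<close> of the circle, \<open>U x\<close> is its least open
    neighbourhood.\<close>
  define U where "U x = (if x = a \<or> x = b then {x} else {a, b, x})" for x
  have open_U: "openin circle (U x)" if "x \<in> topspace circle" for x
    using that distinct by (auto simp: openin_circle U_def)
  have self: "x \<in> U x" for x
    by (simp add: U_def)
  have antisym: "x = y" if "x \<in> U y" "y \<in> U x" for x y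
    using that unfolding U_def by (simp split: if_splits; blast)
  have "t0_space circle"
    unfolding t0_space_def
  proof (intro ballI impI)
    fix x y
    assume xy: "x \<in> topspace circle" "y \<in> topspace circle" "x \<noteq> y"
    show "\<exists>W. openin circle W \<and> (x \<notin> W \<longleftrightarrow> y \<in> W)"
    proof (cases "y \<in> U x")
      case True
      then have "x \<notin> U y"
        using antisym xy(3) by blast
      then show ?thesis
        using open_U [OF xy(2)] self [of y] by blast
    next
      case False
      then show ?thesis
        using open_U [OF xy(1)] self [of x] by blast
    qed
  qed
  then show ?thesis
    by (simp add: finite_t0_space_def)
qed

section \<open>Contractible subspaces and homology of the circle\<close>

lemma contractible_top:
  assumes "z = c \<or> z = d"
  shows "contractible_space (subtopology circle {a, b, z})"
proof (rule contractible_space_top_point)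
  show "z \<in> topspace (subtopology circle {a, b, z})"
    using assms by auto
  show "U = topspace (subtopology circle {a, b, z})"
    if "openin (subtopology circle {a, b, z}) U" "z \<in> U" for U
    using that assms by (auto simp: openin_subtopology openin_circle)
qed

text \<open>With \<open>b\<close> left out, every nonempty relatively open subset of
  \<open>S\<close> contains \<open>a\<close>, since \<open>c\<close> and \<open>d\<close> bring
  \<open>a\<close> along.\<close>

lemma contractible_bottom:
  assumes "a \<in> S" "S \<subseteq> {a, c, d}"
  shows "contractible_space (subtopology circle S)"
proof (rule contractible_space_bottom_point)
  show "a \<in> topspace (subtopology circle S)"
    using assms by auto
  show "a \<in> U" if "openin (subtopology circle S) U" "U \<noteq> {}" for U
    using that assms by (auto simp: openin_subtopology openin_circle)
qed

text \<open>The circle is treated as a suspension of the two points \<open>a\<close>,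
  \<open>b\<close> with cones \<open>?A\<close> and \<open>?B\<close>. Contractibility of
  \<open>?B\<close> gives relative homology, excising \<open>d\<close> leaves \<open>?A\<close>
  relative to its base, and contractibility of \<open>?A\<close> shifts the degree by one.\<close>

lemma reduced_homology_circle:
  "reduced_homology_group p circle \<cong> homology_group (p - 1) (discrete_topology {a})"
proof -
  let ?A = "{a, b, c}" and ?B = "{a, b, d}"
  have "reduced_homology_group p circle \<cong> relative_homology_group p circle ?B"
    using contractible_top [of d] by (intro isomorphic_reduced_homology_by_contractible) auto
  also have "\<dots> \<cong> relative_homology_group p (subtopology circle ?A) {a, b}"
  proof -
    \<comment> \<open>Excision applies because \<open>d\<close> is a closed point inside the open
      cone \<open>?B\<close>.\<close>
    have "closedin circle {d}" "openin circle ?B"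
      using distinct by (auto simp: closedin_def openin_circle)
    then have sub: "circle closure_of {d} \<subseteq> circle interior_of ?B"
      by (simp add: closure_of_closedin interior_of_openin)
    have "{a, b, c, d} - {d} = ?A" "?B - {d} = {a, b}"
      using distinct by auto
    then have "relative_homology_group p (subtopology circle ?A) {a, b}
        \<cong> relative_homology_group p (subtopology circle {a, b, c, d}) ?B"
      using homology_excision_axiom [OF sub, of "{a, b, c, d}" p] by (auto intro: is_isoI)
    moreover have "subtopology circle {a, b, c, d} = circle"
      using subtopology_topspace [of circle] by simp
    ultimately show ?thesis
      by (simp add: group.iso_sym)
  qed
  also have "\<dots> \<cong> reduced_homology_group (p - 1) (subtopology (subtopology circle ?A) {a, b})"
    using contractible_top [of c]
    by (intro isomorphic_group_relative_homology_of_contractible) auto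
  \<comment> \<open>The circle is not T1, but its subspace on \<open>a\<close> and \<open>b\<close>
    is discrete. Passing to a discrete ambient space supplies the T1 condition for splitting off a
    point.\<close>
  also have "subtopology (subtopology circle ?A) {a, b} = subtopology (discrete_topology {a, b}) {a, b}"
    unfolding topology_eq using distinct
    by (auto simp: subtopology_subtopology openin_subtopology openin_circle)
  also have "reduced_homology_group (p - 1) \<dots> \<cong>
      homology_group (p - 1) (subtopology (discrete_topology {a, b}) {a})"
    using distinct by (intro reduced_homology_group_pair) (auto simp: t1_space_def)
  also have "subtopology (discrete_topology {a, b}) {a} = discrete_topology {a}"
    by simp
  finally show ?thesis .
qed

lemma trivial_reduced_homology_circle:
  assumes "p \<noteq> 1"
  shows "trivial_group (reduced_homology_group p circle)"
proof -
  have "trivial_group (homology_group (p - 1) (discrete_topology {a}))"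
    using assms by (intro homology_dimension_axiom [of _ a]) auto
  then show ?thesis
    using isomorphic_group_triviality [OF reduced_homology_circle] by simp
qed

lemma homology_1_circle: "homology_group 1 circle \<cong> integer_group"
  using iso_trans [OF reduced_homology_circle [of 1]] homology_coefficients [of "discrete_topology {a}" a]
  by (simp add: un_reduced_homology_group)

lemma homology_0_circle: "homology_group 0 circle \<cong> integer_group"
proof (rule isomorphic_integer_zeroth_homology_group)
  have "path_connectedin circle {a, b, z}" if "z = c \<or> z = d" for z
    using contractible_imp_path_connected_space [OF contractible_top [OF that]] that
    by (auto simp: path_connectedin_def)
  then have "path_connectedin circle ({a, b, c} \<union> {a, b, d})"
    by (intro path_connectedin_Un) auto
  moreover have "{a, b, c} \<union> {a, b, d} = topspace circle"
    by auto
  ultimately show "path_connected_space circle"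
    using path_connectedin_topspace by metis
qed auto

lemma homology_circle:
  "homology_group (int n) circle \<cong> integer_group \<or> trivial_group (homology_group (int n) circle)"
proof -
  consider "n = 0" | "n = 1" | "n \<ge> 2"
    by linarith
  then show ?thesis
  proof cases
    case 3
    then show ?thesis
      using trivial_reduced_homology_circle [of "int n"] by (simp add: un_reduced_homology_group)
  qed (simp_all add: homology_0_circle homology_1_circle)
qed

text \<open>These facts discharge, in every degree, the assumptions of the trace lemmas
  above.\<close>

lemmas torsion_free_basis_circle =
  torsion_free_basis_if_infinite_cyclic_or_trivial [OF abelian_homology_group homology_circle]

section \<open>Lefschetz numbers on the circle\<close>

lemma lefschetz_number_circle:
  "lefschetz_number circle id \<noteq> lefschetz_number circle (\<lambda>x. a)"
proof -
  let ?t = "\<lambda>f n. (-1) ^ n * homology_trace n circle f"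
  note trace_defs = homology_trace_def Let_def
  have const: "homology_trace n circle (\<lambda>x. a) = 0" if "n \<noteq> 0" for n
    unfolding trace_defs using that
    by (intro comm_group.torsion_free_trace_eq_0 abelian_homology_group torsion_free_basis_circle
        hom_induced_const) auto
  have id2: "homology_trace n circle id = 0" if "n \<ge> 2" for n
    unfolding trace_defs
  \<comment> \<open>The group is trivial in these degrees, so the identity is also the zero
    map.\<close>
  proof (rule comm_group.torsion_free_trace_eq_0 [OF abelian_homology_group torsion_free_basis_circle])
    have "trivial_group (homology_group (int n) circle)"
      using trivial_reduced_homology_circle [of "int n"] that by (simp add: un_reduced_homology_group)
    then show "hom_induced (int n) circle {} circle {} id x = \<one>\<^bsub>homology_group (int n) circle\<^esub>"
      if "x \<in> carrier (homology_group (int n) circle)" for x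
      using that by (simp add: trivial_group_def hom_induced_id)
  qed
  have "\<not> trivial_group integer_group"
    using infinite_UNIV_int finite_subset by (auto simp: group.trivial_group_alt)
  then have id1: "homology_trace 1 circle id \<noteq> 0"
    using isomorphic_group_triviality [OF homology_1_circle]
    unfolding trace_defs
    by (intro comm_group.torsion_free_trace_id_neq_0 abelian_homology_group torsion_free_basis_circle)
       (auto simp: hom_induced_id)
  \<comment> \<open>The common value in degree 0 stays uncomputed: it cancels when the two Lefschetz
    numbers are compared.\<close>
  have eq0: "homology_trace 0 circle id = homology_trace 0 circle (\<lambda>x. a)"
    unfolding trace_defs
  proof (rule comm_group.torsion_free_trace_cong [OF abelian_homology_group torsion_free_basis_circle])
    show "hom_induced (int 0) circle {} circle {} id x = hom_induced (int 0) circle {} circle {} (\<lambda>x. a) x"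
      if "x \<in> carrier (homology_group (int 0) circle)" for x
      unfolding of_nat_0 using that by (intro hom_induced_0_eq trivial_reduced_homology_circle) auto
  qed
  \<comment> \<open>The support of the summand lies in degrees 0 and 1, which turns
    \<open>Sum_any\<close> into an ordinary finite sum.\<close>
  have "lefschetz_number circle f = (\<Sum>n\<in>{0, 1}. ?t f n)"
    if "\<And>n. n \<ge> 2 \<Longrightarrow> homology_trace n circle f = 0" for f
    unfolding lefschetz_number_def
  proof (rule Sum_any.expand_superset)
    show "{n. ?t f n \<noteq> 0} \<subseteq> {0, 1}"
    proof
      fix n
      assume "n \<in> {n. ?t f n \<noteq> 0}"
      then have "\<not> n \<ge> 2"
        using that [of n] by fastforce
      then show "n \<in> {0, 1}"
        by auto
    qed
  qed simp
  then have "lefschetz_number circle f = homology_trace 0 circle f - homology_trace 1 circle f"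
    if "\<And>n. n \<ge> 2 \<Longrightarrow> homology_trace n circle f = 0" for f
    using that by simp
  then show ?thesis
    using const id1 id2 eq0 by simp
qed

section \<open>The multivalued map\<close>

definition F :: "'a \<Rightarrow> 'a set" where
  "F = (\<lambda>x\<in>{a, b, c, d}.
     if x = a then {a} else if x = b then {a, b, c} else if x = c then {a, c} else {a, c, d})"

lemma F_simps: "F a = {a}" "F b = {a, b, c}" "F c = {a, c}" "F d = {a, c, d}"
  using distinct by (auto simp: F_def)

text \<open>Upper semicontinuity: every open set containing \<open>F c\<close> or \<open>F d\<close>
  also contains \<open>F a\<close> and \<open>F b\<close>. Lower semicontinuity: an open set meeting
  \<open>F c\<close> or \<open>F d\<close> contains \<open>a\<close>, which belongs to every
  value.\<close>

lemma continuous_multimap_F: "continuous_multimap circle circle F"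
proof -
  have "multimap circle circle F"
    using distinct by (auto simp: multimap_def F_def)
  moreover have "upper_semicontinuous circle circle F"
    using distinct by (auto simp: upper_semicontinuous_def openin_circle F_simps)
  moreover have "lower_semicontinuous circle circle F"
    using distinct by (auto simp: lower_semicontinuous_def openin_circle F_simps)
  ultimately show ?thesis
    by (simp add: continuous_multimap_def)
qed

lemma acyclic_valued_F: "acyclic_valued circle circle F"
proof -
  have "acyclic_space (subtopology circle (F x))" if x: "x \<in> {a, b, c, d}" for x
  proof (rule acyclic_space_contractible)
    \<comment> \<open>The value at \<open>b\<close> has the top point \<open>c\<close>; every other
      value avoids \<open>b\<close> and has the bottom point \<open>a\<close>.\<close>
    consider "x = b" | "a \<in> F x" "F x \<subseteq> {a, c, d}"
      using x by (auto simp: F_simps)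
    then show "contractible_space (subtopology circle (F x))"
      by cases (simp_all add: F_simps(2) contractible_top contractible_bottom)
    show "topspace (subtopology circle (F x)) \<noteq> {}"
      using x by (auto simp: F_simps)
  qed
  then show ?thesis
    by (simp add: acyclic_valued_def)
qed

end

theorem proposition7p1:
  assumes "infinite (UNIV :: 'a set)"
  shows "\<not> (\<exists>lam :: 'a topology \<Rightarrow> ('a \<Rightarrow> 'a set) \<Rightarrow> int.
           extends_lefschetz lam \<and> selector_invariant lam)"
proof
  assume "\<exists>lam :: 'a topology \<Rightarrow> ('a \<Rightarrow> 'a set) \<Rightarrow> int.
           extends_lefschetz lam \<and> selector_invariant lam"
  then obtain lam :: "'a topology \<Rightarrow> ('a \<Rightarrow> 'a set) \<Rightarrow> int"
    where ext: "extends_lefschetz lam" and inv: "selector_invariant lam"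
    by blast
  have fresh: "\<exists>x. x \<notin> A" if "finite A" for A :: "'a set"
    using ex_new_if_finite [OF assms that] .
  obtain a b c d :: 'a where "b \<notin> {a}" "c \<notin> {a, b}" "d \<notin> {a, b, c}"
    using fresh by (metis finite.emptyI finite.insertI)
  then interpret four_points a b c d
    by unfold_locales auto
  \<comment> \<open>Through \<open>single_multimap circle f\<close> the two properties tie every
    continuous selector to the one number \<open>lam circle F\<close>.\<close>
  have "lefschetz_number circle f = lam circle F"
    if "continuous_map circle circle f" "selector circle F f" for f
    using that ext inv finite_t0_space_circle continuous_multimap_F acyclic_valued_F
    unfolding extends_lefschetz_def selector_invariant_def by metis
  moreover have "selector circle F id" "selector circle F (\<lambda>x. a)"
    by (auto simp: selector_def F_simps)
  ultimately have "lefschetz_number circle id = lefschetz_number circle (\<lambda>x. a)"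
    by simp
  then show False
    using lefschetz_number_circle by blast
qed

end
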